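(* Let $a,b\ge0$, $n\ge1$ and $T\in\mathrm{SHST}(a,b,n)$. For $i\ge1$ and $j\ge 1$ let $N_{i,j}(T)$ be the number of boxes in row $i$ of $T$ with entry at most $j$, and let \[ |\pi(T)|=\sum_{r=1}^{b}\sum_{s=1}^{a} N_{r+1,\,r+s}(T). \] Then \[ \mathrm{charge}(T)+|\pi(T)|=\frac{n\,a\,(a+2b+1)}{2},\qquad \mathrm{cocharge}(T)-|\pi(T)|=\frac{n\,b\,(b+1)}{2}. \]
   Context: $\mathrm{SHST}(a,b,n)$ is the set of semistandard Young tableaux of shape $(n(a+1),n^b)$ (first row $n(a+1)$ boxes, then $b$ rows of $n$ boxes) with each of $1,\dots,a+b+1$ occurring exactly $n$ times. (The array $(N_{r+1,r+s}(T))_{1\le r\le b,1\le s\le a}$ is the plane partition associated with $T$ via its Gelfand--Tsetlin pattern; $|\pi(T)|$ is its entry sum.) The reading word $\mathrm{rw}(T)$ lists entries row by row, left to right, bottom row first. For a permutation $\pi$ of $[r]$, $\mathrm{charge}(\pi)=\mathrm{maj}(\mathrm{rev}(\pi^{-1}))$ and $\mathrm{cocharge}(\pi)=\binom r2-\mathrm{charge}(\pi)$. A word with partition content $(v_1,\dots)$ is split into $v_1$ standard subwords (take the rightmost $1$, move left to the first $2$, then the first $3$, etc., wrapping around to the right end when needed, as long as possible; repeat on unused letters); charge and cocharge of the word (and of $T$, via $\mathrm{rw}(T)$) are the sums over the standard subwords. *)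

theory Defs
  imports Complex_Main
begin

text \<open>
  A tableau is the list of its rows, top row first (English notation); entries are positive.
  The strictness condition on columns presupposes that \<open>lam\<close> is weakly decreasing.
\<close>

definition semistandard :: "nat list \<Rightarrow> nat list list \<Rightarrow> bool" where
  "semistandard lam T \<longleftrightarrow>
     map length T = lam \<and>
     (\<forall>row \<in> set T. sorted row \<and> (\<forall>x \<in> set row. x \<ge> 1)) \<and>
     (\<forall>i j. Suc i < length T \<and> j < length (T ! Suc i) \<longrightarrow> T ! i ! j < T ! Suc i ! j)"

definition SHST :: "nat \<Rightarrow> nat \<Rightarrow> nat \<Rightarrow> nat list list set" where
  "SHST a b n =
     {T. semistandard ((n * (a + 1)) # replicate b n) T \<and>
         (\<forall>k \<in> {1..a + b + 1}. count_list (concat T) k = n)}"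

text \<open>Rows are numbered from 1; rows outside the shape are empty.\<close>

definition tab_row :: "nat list list \<Rightarrow> nat \<Rightarrow> nat list" where
  "tab_row T i = (if 1 \<le> i \<and> i \<le> length T then T ! (i - 1) else [])"

definition N_le :: "nat list list \<Rightarrow> nat \<Rightarrow> nat \<Rightarrow> nat" where
  "N_le T i j = card {c. c < length (tab_row T i) \<and> tab_row T i ! c \<le> j}"

definition pp_size :: "nat \<Rightarrow> nat \<Rightarrow> nat list list \<Rightarrow> nat" where
  "pp_size a b T = (\<Sum>r = 1..b. \<Sum>s = 1..a. N_le T (r + 1) (r + s))"

definition reading_word :: "nat list list \<Rightarrow> nat list" where
  "reading_word T = concat (rev T)"

text \<open>
  A permutation of \<open>{1..r}\<close> is its one-line notation, a list of length \<open>r\<close>.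
  List indices start at 0, hence the occurrences of \<open>Suc\<close> below.
\<close>

definition maj :: "nat list \<Rightarrow> nat" where
  "maj w = (\<Sum>i | Suc i < length w \<and> w ! i > w ! Suc i. Suc i)"

definition perm_inverse :: "nat list \<Rightarrow> nat list" where
  "perm_inverse w =
     map (\<lambda>v. Suc (inv_into {..<length w} ((!) w) v)) [1..<Suc (length w)]"

definition charge_perm :: "nat list \<Rightarrow> nat" where
  "charge_perm w = maj (rev (perm_inverse w))"

definition cocharge_perm :: "nat list \<Rightarrow> int" where
  "cocharge_perm w = int (length w choose 2) - int (charge_perm w)"

text \<open>
  The position of the first letter \<open>k\<close> met when moving left from position \<open>p\<close>
  (exclusive), wrapping around to the right end of the word if there is none.
\<close>

definition next_pos :: "nat list \<Rightarrow> nat \<Rightarrow> nat \<Rightarrow> nat option" where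
  "next_pos w p k =
     (if \<exists>i < length w. i < p \<and> w ! i = k
      then Some (Max {i. i < length w \<and> i < p \<and> w ! i = k})
      else if \<exists>i < length w. w ! i = k
      then Some (Max {i. i < length w \<and> w ! i = k})
      else None)"

text \<open>
  For \<open>k \<ge> 1\<close>, \<open>sel_pos w k\<close> is the position of the letter \<open>k\<close> selected for the first
  standard subword, or \<open>None\<close> if the selection has stopped before \<open>k\<close>. The value at
  0 is the starting point just past the right end, so that the selected 1 is the rightmost one.
\<close>

primrec sel_pos :: "nat list \<Rightarrow> nat \<Rightarrow> nat option" where
  "sel_pos w 0 = Some (length w)"
| "sel_pos w (Suc k) =
     (case sel_pos w k of None \<Rightarrow> None | Some p \<Rightarrow> next_pos w p (Suc k))"

definition sel_set :: "nat list \<Rightarrow> nat set" where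
  "sel_set w = {p. \<exists>k \<ge> 1. sel_pos w k = Some p}"

primrec split_off :: "nat \<Rightarrow> nat list \<Rightarrow> nat list list" where
  "split_off 0 w = []"
| "split_off (Suc m) w = nths w (sel_set w) # split_off m (nths w (- sel_set w))"

definition standard_subwords :: "nat list \<Rightarrow> nat list list" where
  "standard_subwords w = split_off (count_list w 1) w"

definition charge_word :: "nat list \<Rightarrow> nat" where
  "charge_word w = sum_list (map charge_perm (standard_subwords w))"

definition cocharge_word :: "nat list \<Rightarrow> int" where
  "cocharge_word w = sum_list (map cocharge_perm (standard_subwords w))"

definition charge :: "nat list list \<Rightarrow> nat" where
  "charge T = charge_word (reading_word T)"

definition cocharge :: "nat list list \<Rightarrow> int" where
  "cocharge T = cocharge_word (reading_word T)"

end

theory Submission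
  imports Defs
begin

text \<open>
  Put \<open>m = a + b + 1\<close>. In a standard subword, the step from \<open>k\<close> to \<open>k + 1\<close> adds \<open>m - k\<close> to
  the charge if it wraps around and nothing otherwise. As for parking functions, the number of
  wrapping steps from \<open>k\<close> to \<open>k + 1\<close> does not depend on the order in which the letters \<open>k\<close> are
  processed: it is the maximum over the prefixes of the word of the number of letters \<open>k\<close> minus
  the number of letters \<open>k + 1\<close>. For the reading word of \<open>T\<close> this maximum is the number of
  entries \<open>k + 1\<close> in the first row, because a column of the \<open>n\<close>-column rectangle below that row
  cannot contain a \<open>k\<close> in row \<open>i\<close> or lower together with a \<open>k + 1\<close> in row \<open>i\<close> or higher. Hence
  the charge is the sum of \<open>m + 1 - x\<close> over the entries \<open>x > 1\<close> of the first row. Over the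
  whole tableau these weights add up to a constant, and in a lower row they add up to the sum over
  \<open>j \<le> m\<close> of the number of entries at most \<open>j\<close>, which outside the range of the plane partition is
  \<open>0\<close> or \<open>n\<close>.
\<close>

section \<open>Letter counts in prefixes and subsequences\<close>

lemma nths_eq_map_filter:
  "nths xs A = map ((!) xs) (filter (\<lambda>i. i \<in> A) [0..<length xs])"
proof -
  have "zip xs [0..<length xs] = map (\<lambda>i. (xs ! i, i)) [0..<length xs]"
    by (rule nth_equalityI) auto
  then show ?thesis
    unfolding nths_def by (simp add: filter_map o_def)
qed

lemma count_list_eq_card: "count_list xs x = card {i. i < length xs \<and> xs ! i = x}"
proof -
  have "count_list xs x = length (filter (\<lambda>y. y = x) xs)"
    by (induction xs) auto
  then show ?thesis by (simp add: length_filter_conv_card)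
qed

lemma count_list_take_eq_card:
  "i \<le> length w \<Longrightarrow> count_list (take i w) x = card {j. j < i \<and> w ! j = x}"
  unfolding count_list_eq_card by (rule arg_cong[where f = card]) auto

lemma count_list_nths_eq_card:
  "count_list (nths w B) x = card {j. j < length w \<and> j \<in> B \<and> w ! j = x}"
proof -
  have "count_list (nths w B) x = length (filter (\<lambda>j. w ! j = x \<and> j \<in> B) [0..<length w])"
  proof -
    have "count_list (map f xs) x = length (filter (\<lambda>j. f j = x) xs)" for f :: "nat \<Rightarrow> 'a" and xs
      by (induction xs) auto
    then show ?thesis by (simp add: nths_eq_map_filter conj_commute)
  qed
  also have "\<dots> = card {j. j < length w \<and> j \<in> B \<and> w ! j = x}"
    by (simp add: length_filter_conv_card) (rule arg_cong[where f = card], auto)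
  finally show ?thesis .
qed

lemma count_list_take_mono:
  assumes "i \<le> j" "j \<le> length w"
  shows "count_list (take i w) x \<le> count_list (take j w) x"
  using assms by (auto simp: count_list_take_eq_card intro!: card_mono)

lemma count_list_take_cong:
  assumes "i \<le> j" "j \<le> length w" "\<And>l. i \<le> l \<Longrightarrow> l < j \<Longrightarrow> w ! l \<noteq> x"
  shows "count_list (take j w) x = count_list (take i w) x"
proof -
  have "{l. l < j \<and> w ! l = x} = {l. l < i \<and> w ! l = x}"
    using assms by (auto simp: not_le[symmetric])
  then show ?thesis using assms by (simp add: count_list_take_eq_card)
qed

section \<open>Charge of a standard subword from letter positions\<close>

text \<open>The inverse of \<open>v\<close> lists the positions \<open>Suc (q k)\<close> in the
  order of \<open>k\<close>. Reversed, it has a descent at place \<open>m - k\<close>, counted from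
  1, exactly when \<open>k + 1\<close> stands to the right of \<open>k\<close>.\<close>

lemma charge_perm_eq_sum:
  assumes "length v = m" "distinct v"
    and q: "\<And>k. k \<in> {1..m} \<Longrightarrow> q k < m \<and> v ! q k = k"
  shows "charge_perm v = (\<Sum>k = 1..<m. if q k < q (Suc k) then m - k else 0)"
proof -
  let ?u = "perm_inverse v"
  have len: "length ?u = m" using assms by (simp add: perm_inverse_def del: upt_Suc)
  have u: "?u ! i = Suc (q (Suc i))" if "i < m" for i
  proof -
    have "inv_into {..<m} ((!) v) (Suc i) = q (Suc i)"
      using assms that q[of "Suc i"] by (intro inv_into_f_eq) (auto intro!: inj_on_nth)
    then show ?thesis using assms that by (simp add: perm_inverse_def del: upt_Suc)
  qed
  have r: "rev ?u ! i = Suc (q (m - i))" if "i < m" for i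
    using that u[of "m - Suc i"] by (simp add: rev_nth len Suc_diff_Suc)
  have S: "{i. Suc i < length (rev ?u) \<and> rev ?u ! i > rev ?u ! Suc i} =
        {i. Suc i < m \<and> q (m - Suc i) < q (m - i)}"
    using r by (auto simp: len)
  have "charge_perm v = (\<Sum>i | Suc i < m \<and> q (m - Suc i) < q (m - i). Suc i)"
    unfolding charge_perm_def maj_def S ..
  also have "\<dots> = (\<Sum>k | k \<in> {1..<m} \<and> q k < q (Suc k). m - k)"
    by (rule sum.reindex_bij_witness[where i = "\<lambda>k. m - Suc k" and j = "\<lambda>i. m - Suc i"])
       (auto simp: Suc_diff_Suc)
  also have "\<dots> = (\<Sum>k = 1..<m. if q k < q (Suc k) then m - k else 0)"
    unfolding sum.inter_filter[OF finite_atLeastLessThan, symmetric] by (rule refl)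
  finally show ?thesis .
qed

text \<open>Extraction of a subsequence preserves the relative order of positions, so wrapping can
  be tested on positions in \<open>w\<close> itself.\<close>

lemma charge_perm_nths:
  assumes P: "\<And>k. k \<in> {1..m} \<Longrightarrow> P k < length w \<and> w ! P k = k"
  shows "charge_perm (nths w (P ` {1..m})) =
         (\<Sum>k = 1..<m. if P k < P (Suc k) then m - k else 0)"
    and "length (nths w (P ` {1..m})) = m"
proof -
  define L where "L = filter (\<lambda>i. i \<in> P ` {1..m}) [0..<length w]"
  have v: "nths w (P ` {1..m}) = map ((!) w) L"
    by (simp add: nths_eq_map_filter L_def)
  have inj: "inj_on P {1..m}" by (metis P inj_onI)
  have setL: "set L = P ` {1..m}" using P by (auto simp: L_def)
  have dL: "distinct L" by (simp add: L_def)
  have len: "length L = m"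
    using distinct_card[OF dL] setL inj by (simp add: card_image)
  show "length (nths w (P ` {1..m})) = m" using v len by simp
  have sL: "sorted_wrt (<) L" unfolding L_def by (intro sorted_wrt_filter sorted_wrt_upt)
  have "\<exists>i. i < m \<and> L ! i = P k" if "k \<in> {1..m}" for k
    using setL that len by (metis imageI in_set_conv_nth)
  then obtain q where q: "\<And>k. k \<in> {1..m} \<Longrightarrow> q k < m \<and> L ! q k = P k" by metis
  have less: "q k < q l \<longleftrightarrow> P k < P l" if "k \<in> {1..m}" "l \<in> {1..m}" for k l
    using sorted_wrt_nth_less[OF sL, of "q k" "q l"] sorted_wrt_nth_less[OF sL, of "q l" "q k"]
      q[OF that(1)] q[OF that(2)] len by (metis less_asym linorder_neqE_nat)
  have "charge_perm (map ((!) w) L) = (\<Sum>k = 1..<m. if q k < q (Suc k) then m - k else 0)"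
  proof (rule charge_perm_eq_sum)
    show "distinct (map ((!) w) L)"
      using dL P by (auto simp: distinct_map setL inj_on_def)
  qed (use len q P in auto)
  also have "\<dots> = (\<Sum>k = 1..<m. if P k < P (Suc k) then m - k else 0)"
    by (rule sum.cong) (use less in auto)
  finally show "charge_perm (nths w (P ` {1..m})) =
         (\<Sum>k = 1..<m. if P k < P (Suc k) then m - k else 0)" using v by simp
qed

section \<open>Selection of one standard subword\<close>

text \<open>The disjuncts are a plain step to the left and a wrapping step. Wrapping records that no
  letter \<open>k\<close> lies left of \<open>p\<close> and that \<open>q\<close> is the rightmost
  one; both facts control prefix counts later.\<close>

lemma next_pos_cases:
  assumes "k \<in> set w"
  obtains q where "next_pos w p k = Some q" "q < length w" "w ! q = k"
    "(q < p \<and> (\<forall>i. q < i \<and> i < p \<and> i < length w \<longrightarrow> w ! i \<noteq> k)) \<or>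
     (p \<le> q \<and> (\<forall>i < length w. w ! i = k \<longrightarrow> p \<le> i \<and> i \<le> q))"
proof (cases "\<exists>i < length w. i < p \<and> w ! i = k")
  case True
  let ?S = "{i. i < length w \<and> i < p \<and> w ! i = k}"
  have "Max ?S \<in> ?S" using True by (intro Max_in) auto
  moreover have "i \<le> Max ?S" if "i \<in> ?S" for i using that by (intro Max_ge) auto
  ultimately show ?thesis
    using True by (intro that[of "Max ?S"]) (auto simp: next_pos_def not_le[symmetric])
next
  case False
  let ?S = "{i. i < length w \<and> w ! i = k}"
  have ne: "\<exists>i < length w. w ! i = k" using assms by (simp add: in_set_conv_nth)
  have in_S: "Max ?S \<in> ?S" using ne by (intro Max_in) auto
  have ge: "i \<le> Max ?S" if "i \<in> ?S" for i using that by (intro Max_ge) auto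
  have "next_pos w p k = Some (Max ?S)"
    unfolding next_pos_def using False ne by (simp only: if_False if_True)
  moreover have "p \<le> i" if "i < length w" "w ! i = k" for i
    using False that not_less by blast
  ultimately show ?thesis using in_S ge by (intro that[of "Max ?S"]) auto
qed

text \<open>All letters up to \<open>m\<close> occur, so the selection reaches \<open>m\<close>; it
  ends there because \<open>Suc m\<close> is missing. The inequalities of
  \<open>next_pos_cases\<close> become strict because position \<open>P k\<close> carries
  \<open>k\<close> and not \<open>Suc k\<close>.\<close>

lemma sel_set_cases:
  assumes "{1..m} \<subseteq> set w" "Suc m \<notin> set w"
  obtains P where "sel_set w = P ` {1..m}"
    "\<forall>k \<in> {1..m}. P k < length w \<and> w ! P k = k"
    "\<forall>k \<in> {1..<m}.
      (P (Suc k) < P k \<and> (\<forall>i. P (Suc k) < i \<and> i < P k \<longrightarrow> w ! i \<noteq> Suc k)) \<or>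
      (P k < P (Suc k) \<and> (\<forall>i < length w. w ! i = Suc k \<longrightarrow> P k < i \<and> i \<le> P (Suc k)))"
proof -
  define P where "P k = the (sel_pos w k)" for k
  \<comment> \<open>At \<open>k = 0\<close> the value is the starting point \<open>length w\<close>,
    which is not a position of \<open>w\<close>; hence the guard \<open>1 \<le> k\<close>.\<close>
  have S: "sel_pos w k = Some (P k) \<and> (1 \<le> k \<longrightarrow> P k < length w \<and> w ! P k = k)"
    if "k \<le> m" for k
    using that
  proof (induction k)
    case 0
    then show ?case by (simp add: P_def)
  next
    case (Suc k)
    then have "Suc k \<in> set w" using assms by auto
    then obtain q where q: "next_pos w (P k) (Suc k) = Some q" "q < length w" "w ! q = Suc k"
      by (rule next_pos_cases[of _ _ "P k"])
    moreover have "sel_pos w k = Some (P k)" using Suc by simp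
    ultimately have "sel_pos w (Suc k) = Some q" by simp
    then show ?case using q by (simp add: P_def)
  qed
  have none: "sel_pos w (Suc m + d) = None" for d
  proof (induction d)
    case 0
    have "next_pos w (P m) (Suc m) = None"
      using assms(2) by (auto simp: next_pos_def in_set_conv_nth)
    then show ?case using S[of m] by simp
  qed simp
  have "k \<le> m" if "sel_pos w k = Some p" for k p
    using that none[of "k - Suc m"] by (cases "k \<le> m") auto
  then have "(1 \<le> k \<and> sel_pos w k = Some p) \<longleftrightarrow> (k \<in> {1..m} \<and> p = P k)" for k p
    using S[of k] by auto
  then have "sel_set w = P ` {1..m}"
    unfolding sel_set_def by blast
  moreover have "(P (Suc k) < P k \<and> (\<forall>i. P (Suc k) < i \<and> i < P k \<longrightarrow> w ! i \<noteq> Suc k)) \<or>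
      (P k < P (Suc k) \<and> (\<forall>i < length w. w ! i = Suc k \<longrightarrow> P k < i \<and> i \<le> P (Suc k)))"
    if k: "k \<in> {1..<m}" for k
  proof -
    have "Suc k \<in> set w" using assms k by auto
    then obtain q where q: "next_pos w (P k) (Suc k) = Some q"
      "(q < P k \<and> (\<forall>i. q < i \<and> i < P k \<and> i < length w \<longrightarrow> w ! i \<noteq> Suc k)) \<or>
       (P k \<le> q \<and> (\<forall>i < length w. w ! i = Suc k \<longrightarrow> P k \<le> i \<and> i \<le> q))"
      by (rule next_pos_cases[of _ _ "P k"])
    have Sk: "sel_pos w k = Some (P k)" "P k < length w" "w ! P k = k" using S[of k] k by auto
    have Sk': "sel_pos w (Suc k) = Some (P (Suc k))" "w ! P (Suc k) = Suc k"
      using S[of "Suc k"] k by auto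
    have "q = P (Suc k)" using q(1) Sk Sk' by simp
    have lt: "P k < i" if "P k \<le> i" "w ! i = Suc k" for i
      using that Sk by (cases "i = P k") auto
    from q(2) show ?thesis unfolding \<open>q = P (Suc k)\<close>
    proof
      assume "P (Suc k) < P k \<and>
        (\<forall>i. P (Suc k) < i \<and> i < P k \<and> i < length w \<longrightarrow> w ! i \<noteq> Suc k)"
      then show ?thesis using Sk(2) by auto
    next
      assume "P k \<le> P (Suc k) \<and>
        (\<forall>i < length w. w ! i = Suc k \<longrightarrow> P k \<le> i \<and> i \<le> P (Suc k))"
      then show ?thesis using lt Sk' by blast
    qed
  qed
  ultimately show ?thesis using S by (intro that[of P]) simp_all
qed

section \<open>Maximal prefix excess and removal of a subword\<close>

text \<open>
  \<open>max_excess w k c\<close> says that \<open>c\<close> is the maximal excess over all prefixes of \<open>w\<close>; for equal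
  numbers of letters \<open>k\<close> and \<open>k + 1\<close> this is the number of wrapping steps from \<open>k\<close> to \<open>k + 1\<close>.
\<close>

definition excess :: "nat \<Rightarrow> nat list \<Rightarrow> int" where
  "excess k u = int (count_list u k) - int (count_list u (Suc k))"

definition max_excess :: "nat list \<Rightarrow> nat \<Rightarrow> int \<Rightarrow> bool" where
  "max_excess w k c \<longleftrightarrow>
     (\<forall>i \<le> length w. excess k (take i w) \<le> c) \<and> (\<exists>i \<le> length w. excess k (take i w) = c)"

text \<open>Prefixes of a subsequence are the traces of prefixes of \<open>w\<close>, several of
  which may coincide. Excesses before and after a removal can thus be compared at the same index of
  \<open>w\<close>.\<close>

lemma take_nths_iff:
  "(\<exists>i \<le> length (nths w B). u = take i (nths w B)) \<longleftrightarrow> (\<exists>i \<le> length w. u = nths (take i w) B)"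
proof (induction w rule: rev_induct)
  case Nil
  then show ?case by simp
next
  case (snoc x w)
  let ?y = "if length w \<in> B then [x] else []"
  have n: "nths (w @ [x]) B = nths w B @ ?y" by (simp add: nths_append)
  have "(\<exists>i \<le> length (nths (w @ [x]) B). u = take i (nths (w @ [x]) B)) \<longleftrightarrow>
        (\<exists>i \<le> length (nths w B). u = take i (nths w B)) \<or> u = nths (w @ [x]) B"
  proof -
    have "(\<exists>i \<le> length (nths w B @ ?y). u = take i (nths w B @ ?y)) \<longleftrightarrow>
        (\<exists>i \<le> length (nths w B). u = take i (nths w B)) \<or> u = nths w B @ ?y"
      by (auto simp: le_Suc_eq)
    then show ?thesis unfolding n .
  qed
  also have "\<dots> \<longleftrightarrow> (\<exists>i \<le> length (w @ [x]). u = nths (take i (w @ [x])) B)"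
    unfolding snoc by (auto simp: le_Suc_eq)
  finally show ?case .
qed

lemma max_excess_nths:
  "max_excess (nths w B) k c \<longleftrightarrow>
     (\<forall>i \<le> length w. excess k (nths (take i w) B) \<le> c) \<and>
     (\<exists>i \<le> length w. excess k (nths (take i w) B) = c)"
  unfolding max_excess_def using take_nths_iff[of w B] by metis

lemma count_list_nths_Compl_take:
  assumes "i \<le> length w" "{j \<in> A. w ! j = x} = {p}"
  shows "int (count_list (nths (take i w) (- A)) x) =
         int (count_list (take i w) x) - (if p < i then 1 else 0)"
proof -
  have p: "(j \<in> A \<and> w ! j = x) \<longleftrightarrow> j = p" for j using assms(2) by blast
  have "{j. j < length (take i w) \<and> j \<in> - A \<and> take i w ! j = x} = {j. j < i \<and> w ! j = x} - {p}"
  proof (rule set_eqI)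
    fix j
    show "j \<in> {j. j < length (take i w) \<and> j \<in> - A \<and> take i w ! j = x} \<longleftrightarrow>
          j \<in> {j. j < i \<and> w ! j = x} - {p}"
      using p[of j] assms(1) by (cases "j < i") auto
  qed
  then have *: "count_list (nths (take i w) (- A)) x = card ({j. j < i \<and> w ! j = x} - {p})"
    unfolding count_list_nths_eq_card by simp
  have "w ! p = x" using p by blast
  show ?thesis
  proof (cases "p < i")
    case True
    have "card {j. j < i \<and> w ! j = x} = Suc (card ({j. j < i \<and> w ! j = x} - {p}))"
      using True \<open>w ! p = x\<close> by (intro card.remove) auto
    then show ?thesis using True * assms(1) by (simp add: count_list_take_eq_card)
  next
    case False
    then have "{j. j < i \<and> w ! j = x} - {p} = {j. j < i \<and> w ! j = x}" by auto
    then show ?thesis using False * assms(1) by (simp add: count_list_take_eq_card)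
  qed
qed

text \<open>Removal changes the excess only on prefixes that contain exactly one of \<open>p\<close>
  and \<open>q\<close>. Without wrapping, those prefixes gain 1, but they had excess at most
  \<open>c - 1\<close>. With wrapping, they lose 1, and all other prefixes already had excess at
  most \<open>c - 1\<close>.\<close>

lemma max_excess_remove:
  assumes M: "max_excess w k c"
    and eq: "count_list w k = count_list w (Suc k)"
    and A: "{j \<in> A. w ! j = k} = {p}" "{j \<in> A. w ! j = Suc k} = {q}"
    and "p < length w" "q < length w"
    and pq: "(q < p \<and> (\<forall>i. q < i \<and> i < p \<longrightarrow> w ! i \<noteq> Suc k)) \<or>
      (p < q \<and> (\<forall>i < length w. w ! i = Suc k \<longrightarrow> p < i \<and> i \<le> q))"
  shows "max_excess (nths w (- A)) k (c - (if p < q then 1 else 0))"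
proof -
  let ?D = "\<lambda>i. excess k (take i w)"
  let ?E = "\<lambda>i. excess k (nths (take i w) (- A))"
  have E: "?E i = ?D i - (if p < i then 1 else 0) + (if q < i then 1 else 0)"
    if "i \<le> length w" for i
    unfolding excess_def
    using count_list_nths_Compl_take[OF that A(1)] count_list_nths_Compl_take[OF that A(2)] by simp
  have wp: "w ! p = k" using A(1) by blast
  \<comment> \<open>Reading the \<open>k\<close> at \<open>p\<close> raises the excess, so the
    prefix ending just before \<open>p\<close> stays at least 1 below \<open>c\<close>.\<close>
  have Dp: "?D (Suc p) = ?D p + 1"
    using \<open>p < length w\<close> wp by (simp add: excess_def take_Suc_conv_app_nth)
  have le: "?D i \<le> c" if "i \<le> length w" for i using M that by (simp add: max_excess_def)
  obtain i0 where i0: "i0 \<le> length w" "?D i0 = c" using M by (auto simp: max_excess_def)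
  have early: "w ! l \<noteq> Suc k"
    if "\<forall>i < length w. w ! i = Suc k \<longrightarrow> p < i \<and> i \<le> q" "l < p" for l
    using that \<open>p < length w\<close> by (meson less_asym less_trans)
  have mono: "?D i \<le> ?D j"
    if "i \<le> j" "j \<le> length w" "\<And>l. i \<le> l \<Longrightarrow> l < j \<Longrightarrow> w ! l \<noteq> Suc k" for i j
    using count_list_take_mono[OF that(1,2), of k] count_list_take_cong[OF that]
    by (simp add: excess_def)
  from pq show ?thesis
  proof
    assume *: "q < p \<and> (\<forall>i. q < i \<and> i < p \<longrightarrow> w ! i \<noteq> Suc k)"
    have up: "?E i \<le> c" if i: "i \<le> length w" for i
    proof (cases "q < i \<and> i \<le> p")
      case True
      then have "?D i \<le> ?D p" using * \<open>p < length w\<close> by (intro mono) auto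
      also have "\<dots> \<le> c - 1" using Dp le[of "Suc p"] \<open>p < length w\<close> by simp
      finally show ?thesis using E[OF i] True by simp
    next
      case False
      then show ?thesis using E[OF i] le[OF i] * by auto
    qed
    \<comment> \<open>Here \<open>q < p\<close>, so removal lowers no excess and the old maximiser
      still reaches \<open>c\<close>.\<close>
    have "?E i0 \<ge> c" using E[OF i0(1)] i0(2) * by auto
    with up i0(1) have "?E i0 = c" by (simp add: order_antisym)
    with up i0(1) * show ?thesis by (auto simp: max_excess_nths)
  next
    assume *: "p < q \<and> (\<forall>i < length w. w ! i = Suc k \<longrightarrow> p < i \<and> i \<le> q)"
    \<comment> \<open>No \<open>Suc k\<close> precedes \<open>p\<close>, so the excess climbs from 0
      to at least 1 at \<open>p\<close>. This bounds the prefixes beyond \<open>q\<close>, whose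
      excess is at most the final value 0.\<close>
    have "?D 0 \<le> ?D p" using * early \<open>p < length w\<close> by (intro mono) auto
    then have pos: "1 \<le> c" using Dp le[of "Suc p"] \<open>p < length w\<close> by (simp add: excess_def)
    have up: "?E i \<le> c - 1" if i: "i \<le> length w" for i
    proof -
      consider "i \<le> p" | "p < i" "i \<le> q" | "q < i" by linarith
      then show ?thesis
      proof cases
        case 1
        then have "?D i \<le> ?D p" using * early \<open>p < length w\<close> by (intro mono) auto
        also have "\<dots> \<le> c - 1" using Dp le[of "Suc p"] \<open>p < length w\<close> by simp
        finally show ?thesis using E[OF i] 1 * by simp
      next
        case 2
        then show ?thesis using E[OF i] le[OF i] by simp
      next
        case 3
        then have "?D i \<le> ?D (length w)" using * i by (intro mono) force+
        also have "\<dots> = 0" using eq by (simp add: excess_def)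
        finally show ?thesis using E[OF i] 3 * pos by simp
      qed
    qed
    have "?E i0 \<ge> c - 1" using E[OF i0(1)] i0(2) by auto
    with up i0(1) have "?E i0 = c - 1" by (simp add: order_antisym)
    with up i0(1) * show ?thesis by (auto simp: max_excess_nths)
  qed
qed

text \<open>Each induction step removes one subword. By \<open>max_excess_remove\<close> this lowers
  \<open>c k\<close> by 1 exactly when the step from \<open>k\<close> wraps, and
  \<open>charge_perm_nths\<close> credits exactly those steps with \<open>m - k\<close>.\<close>

lemma charge_split_off:
  assumes "set w \<subseteq> {1..m}" "\<And>k. k \<in> {1..m} \<Longrightarrow> count_list w k = n"
    and "\<And>k. k \<in> {1..<m} \<Longrightarrow> max_excess w k (c k)"
  shows "int (sum_list (map charge_perm (split_off n w))) = (\<Sum>k = 1..<m. int (m - k) * c k)"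
    and "\<forall>v \<in> set (split_off n w). length v = m"
  using assms
proof (induction n arbitrary: w c)
  case 0
  {
    case 1
    \<comment> \<open>With no letters left, the empty prefix is the only one and forces
      \<open>c k = 0\<close>.\<close>
    have "w = []"
      using 1(1,2) count_list_0_iff by (metis list.set_intros(1) neq_Nil_conv subsetD)
    then have "c k = 0" if "k \<in> {1..<m}" for k
      using 1(3)[OF that] by (simp add: max_excess_def excess_def)
    then show ?case by simp
  next
    case 2
    then show ?case by simp
  }
next
  case (Suc n)
  have *: "int (sum_list (map charge_perm (split_off (Suc n) w))) =
      (\<Sum>k = 1..<m. int (m - k) * c k) \<and> (\<forall>v \<in> set (split_off (Suc n) w). length v = m)"
    if w: "set w \<subseteq> {1..m}" "\<And>k. k \<in> {1..m} \<Longrightarrow> count_list w k = Suc n"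
      "\<And>k. k \<in> {1..<m} \<Longrightarrow> max_excess w k (c k)" for w c
  proof -
    have "k \<in> set w" if "k \<in> {1..m}" for k
      using w(2)[OF that] by (metis count_list_0_iff nat.distinct(1))
    then have sub: "{1..m} \<subseteq> set w" "Suc m \<notin> set w" using w(1) by auto
    obtain P where P: "sel_set w = P ` {1..m}"
      "\<forall>k \<in> {1..m}. P k < length w \<and> w ! P k = k"
      "\<forall>k \<in> {1..<m}.
      (P (Suc k) < P k \<and> (\<forall>i. P (Suc k) < i \<and> i < P k \<longrightarrow> w ! i \<noteq> Suc k)) \<or>
      (P k < P (Suc k) \<and> (\<forall>i < length w. w ! i = Suc k \<longrightarrow> P k < i \<and> i \<le> P (Suc k)))"
      by (rule sel_set_cases[OF sub])
    have P2: "\<And>k. k \<in> {1..m} \<Longrightarrow> P k < length w \<and> w ! P k = k" using P(2) by blast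
    define A where "A = P ` {1..m}"
    have A: "{j \<in> A. w ! j = k} = {P k}" if "k \<in> {1..m}" for k
      using P(2) that unfolding A_def by fastforce
    define w' where "w' = nths w (- A)"
    define c' where "c' k = c k - (if P k < P (Suc k) then 1 else 0)" for k
    have w'1: "set w' \<subseteq> {1..m}" unfolding w'_def using w(1) set_nths_subset[of w "- A"] by blast
    have w'2: "count_list w' k = n" if "k \<in> {1..m}" for k
      using count_list_nths_Compl_take[OF _ A[OF that], of "length w"] w(2)[OF that] P2[OF that]
      by (simp add: w'_def)
    have w'3: "max_excess w' k (c' k)" if "k \<in> {1..<m}" for k
      unfolding w'_def c'_def
      by (rule max_excess_remove) (use that w P A in auto)
    have so: "split_off (Suc n) w = nths w A # split_off n w'"
      by (simp add: P(1) A_def w'_def)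
    note ch = charge_perm_nths[where m = m and P = P and w = w, OF P2, folded A_def]
    have "int (sum_list (map charge_perm (split_off (Suc n) w))) =
        (\<Sum>k = 1..<m. int (if P k < P (Suc k) then m - k else 0)) + (\<Sum>k = 1..<m. int (m - k) * c' k)"
      unfolding so using ch(1) Suc.IH(1)[OF w'1 w'2 w'3] by simp
    also have "\<dots> = (\<Sum>k = 1..<m. int (m - k) * c k)"
      unfolding sum.distrib[symmetric] by (rule sum.cong) (auto simp: c'_def algebra_simps)
    finally show ?thesis using so ch(2) Suc.IH(2)[OF w'1 w'2 w'3] by simp
  qed
  { case 1 then show ?case using * by blast }
  { case 2 then show ?case using * by blast }
qed

text \<open>All \<open>n\<close> subwords have length \<open>m\<close>, so each contributes the same
  binomial coefficient to the cocharge. By \<open>1 \<le> m\<close> the letter 1 is among those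
  occurring \<open>n\<close> times, which gives the number of subwords.\<close>

lemma charge_cocharge_word:
  assumes "1 \<le> m" "set w \<subseteq> {1..m}" "\<And>k. k \<in> {1..m} \<Longrightarrow> count_list w k = n"
    and "\<And>k. k \<in> {1..<m} \<Longrightarrow> max_excess w k (c k)"
  shows "int (charge_word w) = (\<Sum>k = 1..<m. int (m - k) * c k)"
    and "cocharge_word w = int n * int (m choose 2) - int (charge_word w)"
proof -
  have n: "standard_subwords w = split_off n w"
    using assms(1,3) by (simp add: standard_subwords_def)
  note split = charge_split_off[OF assms(2-4)]
  show "int (charge_word w) = (\<Sum>k = 1..<m. int (m - k) * c k)"
    using split(1) by (simp add: charge_word_def n)
  have len: "length (split_off n' w') = n'" for n' w'
    by (induction n' arbitrary: w') auto
  have "sum_list (map cocharge_perm vs) =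
      int (length vs) * int (m choose 2) - int (sum_list (map charge_perm vs))"
    if "\<forall>v \<in> set vs. length v = m" for vs
    using that by (induction vs) (auto simp: cocharge_perm_def algebra_simps)
  from this[OF split(2)] show "cocharge_word w = int n * int (m choose 2) - int (charge_word w)"
    by (simp add: cocharge_word_def charge_word_def n len)
qed

section \<open>Prefix excesses of a reading word\<close>

lemma count_list_concat_rev: "count_list (concat (rev xs)) x = count_list (concat xs) x"
  by (induction xs) auto

lemma count_list_filter: "count_list (filter P xs) x = (if P x then count_list xs x else 0)"
  by (induction xs) auto

lemma takeWhile_le_eq_filter_sorted:
  fixes xs :: "'a :: linorder list"
  assumes "sorted xs"
  shows "takeWhile (\<lambda>x. x \<le> k) xs = filter (\<lambda>x. x \<le> k) xs"
  using assms
proof (induction xs)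
  case (Cons y ys)
  have "filter (\<lambda>x. x \<le> k) ys = []" if "\<not> y \<le> k"
    using Cons.prems that by (auto simp: filter_empty_conv)
  then show ?case using Cons by simp
qed simp

lemma strict_sorted_nth_add_le:
  fixes xs :: "nat list"
  assumes "sorted_wrt (<) xs" "i + d < length xs"
  shows "xs ! i + d \<le> xs ! (i + d)"
  using assms(2)
proof (induction d)
  case (Suc d)
  then have "xs ! (i + d) < xs ! (i + Suc d)"
    using assms(1) by (intro sorted_wrt_nth_less) auto
  then show ?case using Suc by simp
qed simp

lemma count_list_concat_columns:
  assumes "\<forall>row \<in> set S. length row = n"
  shows "count_list (concat S) x = (\<Sum>c < n. count_list (map (\<lambda>row. row ! c) S) x)"
  using assms
proof (induction S)
  case (Cons row S)
  have "count_list row x = (\<Sum>c < n. if row ! c = x then 1 else 0)"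
    using Cons.prems by (simp add: count_list_eq_card sum.If_cases lessThan_def Int_def)
  then show ?case using Cons by (simp add: sum.distrib[symmetric] if_distrib cong: if_cong)
      (rule sum.cong, auto)
qed simp

text \<open>An entry \<open>Suc k\<close> at index at most \<open>i\<close> forces every entry from
  index \<open>i\<close> on to be at least \<open>Suc k\<close>, so the two counts cannot both be
  positive. Both parts of the column include index \<open>i\<close>.\<close>

lemma count_list_column_le_one:
  assumes "sorted_wrt (<) xs" "i < length xs"
  shows "count_list (drop i xs) k + count_list (take (Suc i) xs) (Suc k) \<le> 1"
proof -
  have dist: "distinct xs" using assms(1) strict_sorted_iff by blast
  have le1: "count_list ys y \<le> 1" if "distinct ys" for ys :: "nat list" and y
    using that by (induction ys) (auto simp: count_list_0_iff)
  have "\<not> (k \<in> set (drop i xs) \<and> Suc k \<in> set (take (Suc i) xs))"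
  proof
    assume *: "k \<in> set (drop i xs) \<and> Suc k \<in> set (take (Suc i) xs)"
    then obtain j where "j < length (drop i xs)" "drop i xs ! j = k"
      by (meson in_set_conv_nth)
    then have j: "i + j < length xs" "xs ! (i + j) = k" using assms(2) by auto
    obtain l where "l < length (take (Suc i) xs)" "take (Suc i) xs ! l = Suc k"
      using * by (meson in_set_conv_nth)
    then have l: "l \<le> i" "xs ! l = Suc k" using assms(2) by auto
    show False using strict_sorted_nth_add_le[OF assms(1), of l "i + j - l"] j l by simp
  qed
  then have "count_list (drop i xs) k = 0 \<or> count_list (take (Suc i) xs) (Suc k) = 0"
    by (simp add: count_list_0_iff)
  then show ?thesis
    using le1[of "drop i xs" k] le1[of "take (Suc i) xs" "Suc k"] dist by auto
qed

text \<open>Each of the \<open>n\<close> columns contributes at most 1. The index \<open>i\<close>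
  will be the row in which a prefix of the reading word ends.\<close>

lemma count_list_drop_take_rows_le:
  assumes "\<forall>row \<in> set S. length row = n" "i < length S"
    and "\<And>c. c < n \<Longrightarrow> sorted_wrt (<) (map (\<lambda>row. row ! c) S)"
  shows "count_list (concat (drop i S)) k + count_list (concat (take (Suc i) S)) (Suc k) \<le> n"
proof -
  let ?col = "\<lambda>c. map (\<lambda>row. row ! c) S"
  have "count_list (concat (drop i S)) k + count_list (concat (take (Suc i) S)) (Suc k) =
      (\<Sum>c < n. count_list (drop i (?col c)) k + count_list (take (Suc i) (?col c)) (Suc k))"
    using assms(1) set_drop_subset[of i S] set_take_subset[of "Suc i" S]
    by (subst (1 2) count_list_concat_columns[where n = n])
       (auto simp: sum.distrib drop_map take_map)
  also have "\<dots> \<le> (\<Sum>c < n. 1)"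
    using assms by (intro sum_mono count_list_column_le_one) auto
  finally show ?thesis by simp
qed

text \<open>Reading starts at the bottom, so the head of \<open>L\<close> is read last. This reduces
  a bound over all prefixes to a case distinction on the row where the prefix ends.\<close>

lemma take_concat_rev:
  assumes "L \<noteq> []"
  shows "\<exists>r < length L. \<exists>j. take i (concat (rev L)) = concat (rev (drop (Suc r) L)) @ take j (L ! r)"
  using assms
proof (induction L)
  case (Cons x xs)
  show ?case
  proof (cases "xs = [] \<or> i > length (concat (rev xs))")
    case True
    then show ?thesis by (intro exI[of _ 0]) auto
  next
    case False
    then obtain r j where "r < length xs"
      "take i (concat (rev xs)) = concat (rev (drop (Suc r) xs)) @ take j (xs ! r)"
      using Cons.IH by blast
    then show ?thesis using False by (intro exI[of _ "Suc r"]) auto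
  qed
qed simp

text \<open>For a prefix ending in \<open>R\<close>, all \<open>k\<close> are offset by the
  \<open>Suc k\<close> in \<open>S\<close>, which number \<open>n\<close> minus those in
  \<open>R\<close>. For a prefix ending in row \<open>t\<close> of \<open>S\<close>, the
  \<open>Suc k\<close> already read are those of \<open>S\<close> outside the rows up to
  \<open>t\<close>, apart from any in row \<open>t\<close> itself, and
  \<open>count_list_drop_take_rows_le\<close> gives the same bound.\<close>

lemma max_excess_rows:
  assumes "sorted R"
    and S: "\<forall>row \<in> set S. length row = n"
      "\<And>c. c < n \<Longrightarrow> sorted_wrt (<) (map (\<lambda>row. row ! c) S)"
    and cnt: "count_list (concat (R # S)) k = n" "count_list (concat (R # S)) (Suc k) = n"
  shows "max_excess (concat (rev (R # S))) k (int (count_list R (Suc k)))"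
proof -
  let ?w = "concat (rev (R # S))"
  have take_le: "count_list (take j xs) x \<le> count_list xs x" for j x and xs :: "nat list"
    by (metis append_take_drop_id count_list_append le_add1)
  have up: "excess k (take i ?w) \<le> int (count_list R (Suc k))" for i
  proof -
    obtain r j where r: "r < length (R # S)"
      "take i ?w = concat (rev (drop (Suc r) (R # S))) @ take j ((R # S) ! r)"
      using take_concat_rev[of "R # S" i] by blast
    show ?thesis
    proof (cases r)
      case 0
      then have "take i ?w = concat (rev S) @ take j R" using r by simp
      then show ?thesis
        using take_le[of j R k] cnt by (simp add: excess_def count_list_concat_rev)
    next
      case (Suc t)
      then have t: "t < length S" and u: "take i ?w = concat (rev (drop (Suc t) S)) @ take j (S ! t)"
        using r by auto
      have "count_list (concat (drop t S)) k = count_list (S ! t) k + count_list (concat (drop (Suc t) S)) k"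
        using t by (simp add: Cons_nth_drop_Suc[symmetric])
      moreover have "count_list (concat S) (Suc k) =
          count_list (concat (take (Suc t) S)) (Suc k) + count_list (concat (drop (Suc t) S)) (Suc k)"
        by (metis append_take_drop_id concat_append count_list_append)
      ultimately show ?thesis
        using count_list_drop_take_rows_le[OF S(1) t S(2), of k] take_le[of j "S ! t" k] cnt
        unfolding u by (simp add: excess_def count_list_concat_rev)
    qed
  qed
  \<comment> \<open>The maximum is attained just before the first entry of \<open>R\<close>
    exceeding \<open>k\<close>: every \<open>k\<close> has been read, and every \<open>Suc k\<close>
    outside \<open>R\<close>.\<close>
  define j where "j = length (takeWhile (\<lambda>x. x \<le> k) R)"
  have "take j R = filter (\<lambda>x. x \<le> k) R"
    using takeWhile_le_eq_filter_sorted[OF \<open>sorted R\<close>, of k]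
      takeWhile_eq_take[of "\<lambda>x. x \<le> k" R] unfolding j_def by argo
  then have "take (length (concat (rev S)) + j) ?w = concat (rev S) @ filter (\<lambda>x. x \<le> k) R"
    by simp
  then have "excess k (take (length (concat (rev S)) + j) ?w) = int (count_list R (Suc k))"
    using cnt by (simp add: excess_def count_list_concat_rev count_list_filter)
  moreover have "length (concat (rev S)) + j \<le> length ?w"
    using length_takeWhile_le[of "\<lambda>x. x \<le> k" R] by (simp add: j_def)
  ultimately show ?thesis using up unfolding max_excess_def by blast
qed

section \<open>Structure of the tableaux\<close>

text \<open>The letters of \<open>A\<close> already fill all \<open>card A * n\<close> places.
  \<open>SHST\<close> prescribes only the counts of \<open>1..a + b + 1\<close>; comparison with the
  size of the shape excludes other entries.\<close>

lemma set_subset_of_count_list: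
  assumes "finite A" "length xs = card A * n" "\<And>x. x \<in> A \<Longrightarrow> count_list xs x = n"
  shows "set xs \<subseteq> A"
proof
  fix y assume y: "y \<in> set xs"
  show "y \<in> A"
  proof (rule ccontr)
    assume "y \<notin> A"
    have "length xs = (\<Sum>x \<in> set xs \<union> A. count_list xs x)"
      using sum_count_set[of xs "set xs \<union> A"] assms(1) by simp
    also have "\<dots> \<ge> (\<Sum>x \<in> insert y A. count_list xs x)"
      using assms(1) y by (intro sum_mono2) auto
    also have "(\<Sum>x \<in> insert y A. count_list xs x) = count_list xs y + length xs"
      using assms \<open>y \<notin> A\<close> by simp
    finally show False using y by (simp add: count_list_0_iff)
  qed
qed

lemma SHST_cases:
  assumes "T \<in> SHST a b n"
  obtains R S where "T = R # S" "sorted R" "length S = b" "\<forall>row \<in> set S. length row = n"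
    "n \<le> length R"
    "\<And>c. c < n \<Longrightarrow> sorted_wrt (<) (map (\<lambda>row. row ! c) T)"
    "\<And>k. k \<in> {1..a + b + 1} \<Longrightarrow> count_list (concat T) k = n"
    "set (concat T) \<subseteq> {1..a + b + 1}"
proof -
  have T: "map length T = (n * (a + 1)) # replicate b n" "\<forall>row \<in> set T. sorted row"
    "\<And>i j. Suc i < length T \<Longrightarrow> j < length (T ! Suc i) \<Longrightarrow> T ! i ! j < T ! Suc i ! j"
    and cnt: "\<And>k. k \<in> {1..a + b + 1} \<Longrightarrow> count_list (concat T) k = n"
    using assms by (auto simp: SHST_def semistandard_def)
  obtain R S where RS: "T = R # S" using T(1) by (cases T) auto
  have S: "map length S = replicate b n" and R: "length R = n * (a + 1)" using T(1) RS by auto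
  have lS: "length S = b" using S by (metis length_map length_replicate)
  have rS: "\<forall>row \<in> set S. length row = n"
    using S by (metis image_eqI in_set_replicate set_map)
  have col: "sorted_wrt (<) (map (\<lambda>row. row ! c) T)" if "c < n" for c
  proof (subst sorted_wrt_iff_nth_Suc_transp)
    show "\<forall>i. Suc i < length (map (\<lambda>row. row ! c) T) \<longrightarrow>
      map (\<lambda>row. row ! c) T ! i < map (\<lambda>row. row ! c) T ! Suc i"
    proof (intro allI impI)
      fix i assume "Suc i < length (map (\<lambda>row. row ! c) T)"
      moreover from this have "length (T ! Suc i) = n" using rS RS by simp
      ultimately show "map (\<lambda>row. row ! c) T ! i < map (\<lambda>row. row ! c) T ! Suc i"
        using T(3)[of i c] that by (simp del: nth_map add: nth_map[of i] nth_map[of "Suc i"])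
    qed
  qed simp
  have "length (concat T) = card {1..a + b + 1} * n"
    using R S RS by (simp add: length_concat sum_list_replicate algebra_simps)
  from set_subset_of_count_list[OF _ this cnt] have "set (concat T) \<subseteq> {1..a + b + 1}" by simp
  then show ?thesis using that[OF RS _ lS rS _ col cnt] T(2) R RS by simp
qed

section \<open>Weighted entry counts of rows\<close>

text \<open>Double counting: an entry \<open>x\<close> is at most \<open>j\<close> for exactly
  \<open>m + 1 - x\<close> values of \<open>j\<close> in \<open>1..m\<close>.\<close>

lemma weighted_count_eq_sum_le:
  assumes "set xs \<subseteq> {1..m}"
  shows "(\<Sum>j = 1..m. (m + 1 - j) * count_list xs j) = (\<Sum>j = 1..m. length (filter (\<lambda>x. x \<le> j) xs))"
  using assms
proof (induction xs)
  case (Cons x xs)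
  have x: "x \<in> {1..m}" using Cons.prems by simp
  have "(\<Sum>j = 1..m. (m + 1 - j) * count_list (x # xs) j) =
      (\<Sum>j = 1..m. if x = j then m + 1 - j else 0) + (\<Sum>j = 1..m. (m + 1 - j) * count_list xs j)"
    unfolding sum.distrib[symmetric] by (rule sum.cong) auto
  also have "(\<Sum>j = 1..m. if x = j then m + 1 - j else 0) = m + 1 - x" using x by simp
  also have "m + 1 - x = (\<Sum>j = 1..m. if x \<le> j then 1 else 0)"
  proof -
    have "{1..m} \<inter> {j. x \<le> j} = {x..m}" using x by auto
    then show ?thesis by (simp add: sum.If_cases)
  qed
  also have "(\<Sum>j = 1..m. (m + 1 - j) * count_list xs j) = (\<Sum>j = 1..m. length (filter (\<lambda>x. x \<le> j) xs))"
    using Cons by simp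
  finally show ?case unfolding sum.distrib[symmetric]
    by (simp cong: if_cong) (rule sum.cong, auto)
qed simp

lemma N_le_Cons:
  assumes "r \<in> {1..length S}"
  shows "N_le (R # S) (r + 1) j = length (filter (\<lambda>x. x \<le> j) (S ! (r - 1)))"
  using assms by (simp add: N_le_def tab_row_def length_filter_conv_card)

section \<open>Comparison of row weights with charge and cocharge\<close>

theorem mainTheorem3:
  fixes a b n :: nat and T :: "nat list list"
  assumes "n \<ge> 1"
    and "T \<in> SHST a b n"
  shows "real (charge T) + real (pp_size a b T) = real (n * a * (a + 2 * b + 1)) / 2 \<and>
         real_of_int (cocharge T) - real (pp_size a b T) = real (n * b * (b + 1)) / 2"
proof -
  obtain R S where RS: "T = R # S" "sorted R" "length S = b" "\<forall>row \<in> set S. length row = n"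
    "n \<le> length R"
    and col: "\<And>c. c < n \<Longrightarrow> sorted_wrt (<) (map (\<lambda>row. row ! c) T)"
    and cnt: "\<And>k. k \<in> {1..a + b + 1} \<Longrightarrow> count_list (concat T) k = n"
    and sub: "set (concat T) \<subseteq> {1..a + b + 1}"
    using SHST_cases[OF assms(2)] by blast
  define m where "m = a + b + 1"
  \<comment> \<open>An entry \<open>x = k + 1\<close> gets weight \<open>m - k\<close>, the charge
    of a wrapping step from \<open>k\<close> to \<open>k + 1\<close>.\<close>
  define G where "G xs = (\<Sum>j = 1..m. (m + 1 - j) * count_list xs j)" for xs
  \<comment> \<open>Row \<open>r + 1\<close> of \<open>T\<close> is \<open>S ! (r - 1)\<close>. In
    its column \<open>r\<close> strictly smaller entries lie above and \<open>b - r\<close> strictly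
    larger ones below, all within \<open>1..m\<close>.\<close>
  have entry: "r + 1 \<le> S ! (r - 1) ! c" "S ! (r - 1) ! c \<le> r + a + 1"
    if r: "r \<in> {1..b}" and c: "c < n" for r c
  proof -
    let ?col = "map (\<lambda>row. row ! c) T"
    have colr: "?col ! r = S ! (r - 1) ! c" using r RS by (cases r) auto
    have col_mem: "?col ! l \<in> {1..m}" if "l \<in> {0, b}" for l
    proof -
      have "l < length T" using that RS by auto
      then have "T ! l \<in> set T" by simp
      moreover from this have "c < length (T ! l)" using c RS by auto
      ultimately have "T ! l ! c \<in> set (concat T)" by (auto intro: bexI[of _ "T ! l"])
      then show ?thesis using sub \<open>l < length T\<close> by (auto simp: m_def)
    qed
    have "?col ! 0 + r \<le> ?col ! r"
      using strict_sorted_nth_add_le[OF col[OF c], of 0 r] r RS by simp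
    moreover have "?col ! r + (b - r) \<le> ?col ! b"
      using strict_sorted_nth_add_le[OF col[OF c], of r "b - r"] r RS by simp
    ultimately show "r + 1 \<le> S ! (r - 1) ! c" "S ! (r - 1) ! c \<le> r + a + 1"
      using col_mem[of 0] col_mem[of b] r colr by (auto simp: m_def)
  qed
  have G_row: "G (S ! (r - 1)) = (\<Sum>s = 1..a. N_le T (r + 1) (r + s)) + n * (b + 1 - r)"
    if r: "r \<in> {1..b}" for r
  proof -
    let ?row = "S ! (r - 1)"
    have row: "?row \<in> set S" using r RS by auto
    then have len: "length ?row = n" using RS by simp
    have ent: "r + 1 \<le> x \<and> x \<le> r + a + 1" if "x \<in> set ?row" for x
      using entry[OF r] that len by (metis in_set_conv_nth)
    have "G ?row = (\<Sum>j = 1..m. length (filter (\<lambda>x. x \<le> j) ?row))"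
      unfolding G_def using row sub RS by (intro weighted_count_eq_sum_le) (auto simp: m_def)
    also have "\<dots> = (\<Sum>j = 1..m. N_le T (r + 1) j)"
      using N_le_Cons[of r S R] r RS by simp
    \<comment> \<open>By \<open>entry\<close> the row has no entry at most \<open>r\<close>, and all
      its entries are at most \<open>r + a + 1\<close>. The middle range is its row of the plane
      partition; the last range consists of \<open>b + 1 - r\<close> values of
      \<open>j\<close>.\<close>
    also have "{1..m} = {1..r} \<union> ({r + 1..r + a} \<union> {r + a + 1..m})"
      using r by (auto simp: m_def)
    also have "(\<Sum>j \<in> \<dots>. N_le T (r + 1) j) = (\<Sum>j = 1..r. N_le T (r + 1) j) +
        ((\<Sum>j = r + 1..r + a. N_le T (r + 1) j) + (\<Sum>j = r + a + 1..m. N_le T (r + 1) j))"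
      by (subst sum.union_disjoint, simp, simp, force)
         (subst sum.union_disjoint, auto)
    also have "(\<Sum>j = 1..r. N_le T (r + 1) j) = 0"
      using N_le_Cons[of r S R] r RS ent by (fastforce simp: filter_empty_conv)
    also have "(\<Sum>j = r + 1..r + a. N_le T (r + 1) j) = (\<Sum>s = 1..a. N_le T (r + 1) (r + s))"
      using sum.shift_bounds_cl_nat_ivl[of "N_le T (r + 1)" 1 r a] by (simp add: add.commute)
    also have "(\<Sum>j = r + a + 1..m. N_le T (r + 1) j) = (\<Sum>j = r + a + 1..m. n)"
    proof (rule sum.cong)
      fix j assume "j \<in> {r + a + 1..m}"
      then have "filter (\<lambda>x. x \<le> j) ?row = ?row" using ent by (fastforce intro: filter_True)
      then show "N_le T (r + 1) j = n" using N_le_Cons[of r S R] r RS len by simp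
    qed simp
    also have "\<dots> = n * (b + 1 - r)" using r by (simp add: m_def)
    finally show ?thesis by simp
  qed
  have G_append: "G (xs @ ys) = G xs + G ys" for xs ys
    by (simp add: G_def algebra_simps sum.distrib)
  have G_concat: "G (concat xss) = sum_list (map G xss)" for xss
    by (induction xss) (simp_all add: G_append, simp add: G_def)
  have "G (concat S) = (\<Sum>i = 0..<b. G (S ! i))"
    unfolding G_concat using RS by (simp add: sum_list_sum_nth)
  also have "\<dots> = (\<Sum>r = 1..b. G (S ! (r - 1)))"
    by (rule sum.reindex_bij_witness[where i = "\<lambda>r. r - 1" and j = Suc]) auto
  also have "\<dots> = pp_size a b T + n * (\<Sum>r = 1..b. b + 1 - r)"
    using G_row by (simp add: pp_size_def sum.distrib sum_distrib_left)
  finally have GS: "G (concat S) = pp_size a b T + n * (\<Sum>r = 1..b. b + 1 - r)" .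
  have GT: "G R + G (concat S) = n * (\<Sum>r = 1..m. m + 1 - r)"
  proof -
    have "G R + G (concat S) = G (concat T)" using RS G_append by simp
    also have "\<dots> = n * (\<Sum>r = 1..m. m + 1 - r)"
      using cnt by (simp add: G_def m_def sum_distrib_left mult.commute)
    finally show ?thesis .
  qed
  have tri: "2 * (\<Sum>r = 1..d. d + 1 - r) = d * (d + 1)" for d :: nat
  proof -
    have "(\<Sum>r = 1..d. d + 1 - r) = (\<Sum>r = 1..d. r)"
      by (rule sum.reindex_bij_witness[where i = "\<lambda>r. d + 1 - r" and j = "\<lambda>r. d + 1 - r"]) auto
    then show ?thesis using gauss_sum_from_Suc_0[of d, where 'a = nat] by simp
  qed
  \<comment> \<open>Entries below the first row are at least 2. The 1s of \<open>R\<close> account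
    for \<open>m * n\<close> in \<open>G R\<close>, and the rest of \<open>G R\<close> is the
    charge.\<close>
  have R1: "count_list R 1 = n"
  proof -
    have "1 \<notin> set (concat S)"
    proof
      assume "1 \<in> set (concat S)"
      then obtain i c where "i < b" "c < n" "S ! i ! c = 1"
        using RS by (auto simp: in_set_conv_nth)
      then show False using entry(1)[of "Suc i" c] by simp
    qed
    then show ?thesis using cnt[of 1] RS by (simp add: count_list_0_iff)
  qed
  have w: "set (reading_word T) \<subseteq> {1..m}" "\<And>k. k \<in> {1..m} \<Longrightarrow> count_list (reading_word T) k = n"
    using sub cnt by (simp_all add: reading_word_def m_def count_list_concat_rev)
  have colS: "sorted_wrt (<) (map (\<lambda>row. row ! c) S)" if "c < n" for c
    using col[OF that] RS by simp
  have ex: "max_excess (reading_word T) k (int (count_list R (Suc k)))" if "k \<in> {1..<m}" for k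
    unfolding reading_word_def RS(1)
    using that cnt RS by (intro max_excess_rows[OF RS(2) RS(4) colS]) (auto simp: m_def)
  have "1 \<le> m" by (simp add: m_def)
  note ch = charge_cocharge_word[OF \<open>1 \<le> m\<close> w ex, folded charge_def cocharge_def]
  have "G R = m * count_list R 1 + (\<Sum>j = Suc 1..m. (m + 1 - j) * count_list R j)"
    unfolding G_def using \<open>1 \<le> m\<close> by (subst sum.atLeast_Suc_atMost) auto
  also have "(\<Sum>j = Suc 1..m. (m + 1 - j) * count_list R j) =
      (\<Sum>k = 1..<m. (m - k) * count_list R (Suc k))"
    by (rule sum.reindex_bij_witness[where i = Suc and j = "\<lambda>j. j - 1"]) auto
  also have "\<dots> = charge T"
    using ch(1) by (simp only: of_nat_mult[symmetric] of_nat_sum[symmetric] of_nat_eq_iff)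
  finally have "G R = m * n + charge T" using R1 by simp
  then have "m * n + charge T + pp_size a b T + n * (\<Sum>r = 1..b. b + 1 - r) =
      n * (\<Sum>r = 1..m. m + 1 - r)"
    using GS GT by simp
  \<comment> \<open>Doubling lets \<open>tri\<close> evaluate both sums without division.\<close>
  then have "2 * (m * n + charge T + pp_size a b T) + n * (2 * (\<Sum>r = 1..b. b + 1 - r)) =
      n * (2 * (\<Sum>r = 1..m. m + 1 - r))"
    by (simp add: algebra_simps)
  then have "2 * (m * n + charge T + pp_size a b T) + n * (b * (b + 1)) = n * (m * (m + 1))"
    unfolding tri .
  \<comment> \<open>With \<open>m = a + b + 1\<close>,
    \<open>m * (m + 1) - 2 * m - b * (b + 1) = a * (a + 2 * b + 1)\<close>.\<close>
  then have main: "2 * (charge T + pp_size a b T) = n * a * (a + 2 * b + 1)"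
    by (simp add: m_def algebra_simps)
  then have c1: "2 * (real (charge T) + real (pp_size a b T)) = real (n * a * (a + 2 * b + 1))"
    by (metis of_nat_add of_nat_mult of_nat_numeral)
  have "2 * (m choose 2) = m * (m - 1)"
    unfolding choose_two by (rule dvd_mult_div_cancel) auto
  then have ch2: "2 * real (m choose 2) = real ((a + b + 1) * (a + b))"
    by (metis add_diff_cancel_right' m_def of_nat_mult of_nat_numeral)
  have "real_of_int (cocharge T) = real n * real (m choose 2) - real (charge T)"
    using ch(2) by simp
  then have "2 * (real_of_int (cocharge T) - real (pp_size a b T)) =
      real n * real ((a + b + 1) * (a + b)) - 2 * (real (charge T) + real (pp_size a b T))"
    unfolding ch2[symmetric] by (simp add: algebra_simps)
  \<comment> \<open>This is
    \<open>(a + b + 1) * (a + b) - a * (a + 2 * b + 1) = b * (b + 1)\<close>, multiplied by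
    \<open>n\<close>.\<close>
  then have "2 * (real_of_int (cocharge T) - real (pp_size a b T)) = real (n * b * (b + 1))"
    unfolding c1 by (simp add: algebra_simps)
  then show ?thesis using c1 by simp
qed

end
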